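(* Assume that $\mathbf{P}(|X|>x)=L(x)x^{-r}$ for some $r>1$, where $L$ is slowly varying at infinity, and that $$\frac{\mathbf{P}(X>x)}{\mathbf{P}(|X|>x)}\to p\in(0,1)\quad\text{as }x\to\infty.$$ Then, for every $\theta\in(0,1)$ and every $z>0$, $$\limsup_{x\to\infty}\frac{\mathbf{P}(M>x)}{G(x)}\le\frac{\mathbf{E}[\tau_z]}{z}\,\theta^{-r}.$$
   Context: $X_1,X_2,\ldots$ are independent copies of a real random variable $X$ with finite mean and $a:=-\mathbf{E}[X]>0$. $S_0:=0$ and $S_n:=\sum_{i=1}^n X_i$ for $n\ge1$; $M:=\max_{k\ge0}S_k$ (almost surely finite). For $z>0$, $\tau_z:=\min\{k\ge 0: S_k\le -z\}$ (almost surely finite, with finite mean). $G(x):=\int_x^\infty\mathbf{P}(X>u)\,du$ is the integrated tail. *)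

theory Defs
  imports "HOL-Probability.Probability"
begin

definition partial_sum :: "(nat \<Rightarrow> 'a \<Rightarrow> real) \<Rightarrow> nat \<Rightarrow> 'a \<Rightarrow> real" where
  "partial_sum Xs n \<omega> = (\<Sum>i=1..n. Xs i \<omega>)"

(* Extended-real supremum; it is the maximum at every \<omega> where the maximum exists
   (for negative drift, almost surely). *)
definition walk_max :: "(nat \<Rightarrow> 'a \<Rightarrow> real) \<Rightarrow> 'a \<Rightarrow> ereal" where
  "walk_max Xs \<omega> = (SUP k. ereal (partial_sum Xs k \<omega>))"

(* The infimum in enat is the minimum when the level -z is reached, and \<infinity> otherwise. *)
definition passage_time :: "(nat \<Rightarrow> 'a \<Rightarrow> real) \<Rightarrow> real \<Rightarrow> 'a \<Rightarrow> enat" where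
  "passage_time Xs z \<omega> = (INF k\<in>{k. partial_sum Xs k \<omega> \<le> - z}. enat k)"

definition integrated_tail :: "'a measure \<Rightarrow> ('a \<Rightarrow> real) \<Rightarrow> real \<Rightarrow> real" where
  "integrated_tail P X x = (LBINT u:{x..}. \<P>(\<omega> in P. X \<omega> > u))"

(* Positivity and measurability are only required in a neighbourhood of infinity. *)
definition slowly_varying :: "(real \<Rightarrow> real) \<Rightarrow> bool" where
  "slowly_varying L \<longleftrightarrow>
     (\<exists>A. set_borel_measurable borel {A..} L \<and> (\<forall>x\<ge>A. L x > 0)) \<and>
     (\<forall>c>0. ((\<lambda>x. L (c * x) / L x) \<longlongrightarrow> 1) at_top)"

end

theory Submission
  imports Defs
begin

text \<open>
  Write \<open>q x\<close> for the probability that the walk exceeds \<open>x\<close> before \<open>\<tau>\<^sub>z\<close>, and \<open>T\<close> for the tail of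
  \<open>X\<close>. If \<open>E \<tau>\<^sub>z = \<infinity>\<close> there is nothing to show. Otherwise restarting the walk at \<open>\<tau>\<^sub>z\<close>, from a level
  at most \<open>- z\<close>, gives \<open>P(M > x) \<le> (\<Sum>j. q (x + j z))\<close>, and the right-hand side is finite because the
  maximum over a cycle is dominated by the sum of the positive parts of its steps.

  A cycle that exceeds \<open>x\<close> either contains a step larger than \<open>t x\<close>, which has probability at most
  \<open>E \<tau>\<^sub>z T (t x)\<close>, or it first exceeds \<open>s x\<close> without exceeding \<open>(s + t) x\<close> and still climbs
  \<open>(1 - s - t) x\<close>. Hence
  \<open>q x \<le> E \<tau>\<^sub>z T (t x) + q (s x) P(M > (1 - s - t) x)\<close>. Since \<open>P(M > y) \<rightarrow> 0\<close> and \<open>T\<close> is regularly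
  varying, iterating this with \<open>s = t = 1/4\<close> yields \<open>q = O(T)\<close>; inserting that bound once more with
  \<open>t = \<theta>\<close> yields \<open>q x \<le> (E \<tau>\<^sub>z \<theta>\<^sup>-\<^sup>r + o(1)) T x\<close>. Summing over \<open>x + j z\<close> compares with \<open>G x / z\<close>.
\<close>

section \<open>Independence of past and future\<close>

declare One_nat_def [simp del]

locale iid_walk = prob_space P for P :: "'a measure" +
  fixes X :: "'a \<Rightarrow> real" and Xs :: "nat \<Rightarrow> 'a \<Rightarrow> real"
  assumes rv_X [measurable]: "X \<in> borel_measurable P"
    and indep: "indep_vars (\<lambda>_. borel) Xs {1..}"
    and ident: "i \<ge> 1 \<Longrightarrow> distr P borel (Xs i) = distr P borel X"
begin

abbreviation "S \<equiv> partial_sum Xs"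

lemma rv_Xs: "i \<ge> 1 \<Longrightarrow> Xs i \<in> borel_measurable P"
  using indep by (auto simp: indep_vars_def)

lemma rv_S [measurable]: "S n \<in> borel_measurable P"
  unfolding partial_sum_def by (intro borel_measurable_sum rv_Xs) auto

lemma S_add: "S (m + k) \<omega> - S m \<omega> = (\<Sum>i=1..k. Xs (m + i) \<omega>)"
proof -
  have "(\<Sum>i=1..m + k. Xs i \<omega>) = (\<Sum>i=1..m. Xs i \<omega>) + (\<Sum>i=m+1..m + k. Xs i \<omega>)"
    using sum.ub_add_nat[of 1 m "\<lambda>i. Xs i \<omega>" k] by simp
  also have "(\<Sum>i=m+1..m + k. Xs i \<omega>) = (\<Sum>i=1..k. Xs (m + i) \<omega>)"
    using sum.shift_bounds_cl_nat_ivl[of "\<lambda>i. Xs i \<omega>" 1 m k] by (simp add: add.commute)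
  finally show ?thesis by (simp add: partial_sum_def)
qed

text \<open>Indices start again at 1, so the futures for all \<open>m\<close> live in one product
  space and \<open>future 0\<close> is the original step sequence; this lets their laws be
  compared.\<close>

definition future :: "nat \<Rightarrow> 'a \<Rightarrow> nat \<Rightarrow> real" where
  "future m \<omega> = (\<lambda>i\<in>{1..}. Xs (m + i) \<omega>)"

definition past :: "nat \<Rightarrow> 'a \<Rightarrow> nat \<Rightarrow> real" where
  "past m \<omega> = (\<lambda>i\<in>{1..m}. Xs i \<omega>)"

lemma measurable_past [measurable]: "past m \<in> measurable P (PiM {1..m} (\<lambda>_. borel))"
  unfolding past_def by (intro measurable_restrict rv_Xs) auto

lemma measurable_future [measurable]: "future m \<in> measurable P (PiM {1..} (\<lambda>_. borel))"
  unfolding future_def by (intro measurable_restrict rv_Xs) auto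

lemma measurable_reindex:
  "(\<lambda>f. \<lambda>i\<in>{1..}. f (m + i :: nat)) \<in> measurable (PiM {m+1..} (\<lambda>_. borel)) (PiM {1..} (\<lambda>_. borel :: real measure))"
  by (intro measurable_restrict measurable_component_singleton) simp

lemma future_reindex:
  "future m = (\<lambda>f. \<lambda>i\<in>{1..}. f (m + i)) \<circ> (\<lambda>\<omega>. restrict (\<lambda>i. Xs i \<omega>) {m+1..})"
  by (auto simp: future_def fun_eq_iff)

text \<open>Independence makes the law of the steps after time \<open>m\<close> a product of
  identical factors, and relabelling the indices by an injective shift preserves such a product.
  Hence the law is the same for every \<open>m\<close>.\<close>

lemma distr_future: "distr P (PiM {1..} (\<lambda>_. borel)) (future m) = PiM {1..} (\<lambda>_. distr P borel X)"
proof -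
  let ?D = "distr P borel X" and ?t = "\<lambda>f. \<lambda>i\<in>{1::nat..}. f (m + i) :: real"
  let ?X = "\<lambda>\<omega>. \<lambda>i\<in>{m+1..}. Xs i \<omega>"
  have D: "prob_space ?D" by (rule prob_space_distr) simp
  have ind: "indep_vars (\<lambda>_. borel) Xs {m+1..}"
    by (rule indep_vars_subset[OF indep]) auto
  have "distr P (PiM {m+1..} (\<lambda>_. borel)) ?X = PiM {m+1..} (\<lambda>i. distr P borel (Xs i))"
    using ind by (subst (asm) indep_vars_iff_distr_eq_PiM') (auto intro: rv_Xs)
  also have "\<dots> = PiM {m+1..} (\<lambda>_. ?D)" by (intro PiM_cong ident) auto
  finally have *: "distr P (PiM {m+1..} (\<lambda>_. borel)) ?X = PiM {m+1..} (\<lambda>_. ?D)" .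
  have "distr P (PiM {1..} (\<lambda>_. borel)) (future m)
      = distr (distr P (PiM {m+1..} (\<lambda>_. borel)) ?X) (PiM {1..} (\<lambda>_. borel)) ?t"
    unfolding future_reindex
    by (intro distr_distr[symmetric] measurable_reindex measurable_restrict rv_Xs) auto
  also have "\<dots> = distr (PiM {m+1..} (\<lambda>_. ?D)) (PiM {1..} (\<lambda>_. ?D)) ?t"
    unfolding * by (intro distr_cong refl sets_PiM_cong) auto
  also have "\<dots> = PiM {1..} (\<lambda>_. ?D)"
    using D by (intro distr_PiM_reindex[where f="(+) m" and M="\<lambda>_. ?D"]) (auto simp: inj_on_def)
  finally show ?thesis .
qed

lemma indep_past_future:
  "indep_var (PiM {1..m} (\<lambda>_. borel)) (past m) (PiM {1..} (\<lambda>_. borel)) (future m)"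
proof -
  have "indep_var (PiM {1..m} (\<lambda>_. borel)) (\<lambda>\<omega>. restrict (\<lambda>i. Xs i \<omega>) {1..m})
      (PiM {m+1..} (\<lambda>_. borel)) (\<lambda>\<omega>. restrict (\<lambda>i. Xs i \<omega>) {m+1..})"
    by (rule indep_var_restrict[OF indep]) auto
  from indep_var_compose[OF this measurable_ident measurable_reindex]
  show ?thesis unfolding future_reindex past_def comp_def id_def .
qed

text \<open>The Markov property at the fixed time \<open>m\<close>: past and future have a product
  law, Tonelli separates the factors, and \<open>future m\<close> is replaced by
  \<open>future 0\<close> because the laws agree.\<close>

lemma nn_integral_past_future:
  assumes A: "A \<in> sets (PiM {1..m} (\<lambda>_. borel))"
    and g [measurable]: "g \<in> borel_measurable (PiM {1..} (\<lambda>_. borel))"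
  shows "(\<integral>\<^sup>+\<omega>. indicator A (past m \<omega>) * g (future m \<omega>) \<partial>P)
    = emeasure P {\<omega>\<in>space P. past m \<omega> \<in> A} * (\<integral>\<^sup>+\<omega>. g (future 0 \<omega>) \<partial>P)"
proof -
  let ?S = "PiM {1..m} (\<lambda>_. borel :: real measure)" and ?T = "PiM {1::nat..} (\<lambda>_. borel :: real measure)"
  note [measurable] = A
  let ?DS = "distr P ?S (past m)" and ?DT = "distr P ?T (future m)"
  interpret DT: prob_space ?DT by (rule prob_space_distr) simp
  have eq: "?DS \<Otimes>\<^sub>M ?DT = distr P (?S \<Otimes>\<^sub>M ?T) (\<lambda>\<omega>. (past m \<omega>, future m \<omega>))"
    using indep_past_future[of m] by (simp add: indep_var_distribution_eq)
  have "(\<integral>\<^sup>+\<omega>. indicator A (past m \<omega>) * g (future m \<omega>) \<partial>P)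
      = (\<integral>\<^sup>+ x. indicator A (fst x) * g (snd x) \<partial>(?DS \<Otimes>\<^sub>M ?DT))"
    unfolding eq by (subst nn_integral_distr) auto
  also have "\<dots> = (\<integral>\<^sup>+ x. \<integral>\<^sup>+ y. indicator A x * g y \<partial>?DT \<partial>?DS)"
    by (subst DT.nn_integral_fst[symmetric]) auto
  also have "\<dots> = (\<integral>\<^sup>+ x. indicator A x * (\<integral>\<^sup>+ y. g y \<partial>?DT) \<partial>?DS)"
    by (subst nn_integral_cmult) auto
  also have "\<dots> = emeasure ?DS A * (\<integral>\<^sup>+ y. g y \<partial>?DT)"
    by (subst nn_integral_multc) auto
  also have "emeasure ?DS A = emeasure P {\<omega>\<in>space P. past m \<omega> \<in> A}"
    by (subst emeasure_distr) (auto intro!: arg_cong[where f="emeasure P"])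
  also have "?DT = distr P ?T (future 0)" unfolding distr_future ..
  also have "(\<integral>\<^sup>+ y. g y \<partial>distr P ?T (future 0)) = (\<integral>\<^sup>+\<omega>. g (future 0 \<omega>) \<partial>P)"
    by (subst nn_integral_distr) auto
  finally show ?thesis .
qed

text \<open>Membership in the sigma-algebra of the first \<open>m\<close> steps, phrased for
  predicates, so that stopping events can be built with conjunction, negation and bounded
  quantification.\<close>

definition past_event :: "nat \<Rightarrow> ('a \<Rightarrow> bool) \<Rightarrow> bool" where
  "past_event m E \<longleftrightarrow>
    (\<exists>A\<in>sets (PiM {1..m} (\<lambda>_. borel)). \<forall>\<omega>\<in>space P. E \<omega> \<longleftrightarrow> past m \<omega> \<in> A)"

lemma past_eventI:
  assumes "Measurable.pred (PiM {1..m} (\<lambda>_. borel)) R" and "\<And>\<omega>. \<omega> \<in> space P \<Longrightarrow> E \<omega> \<longleftrightarrow> R (past m \<omega>)"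
  shows "past_event m E"
  unfolding past_event_def
  using assms measurable_space[OF measurable_past[of m]]
  by (intro bexI[of _ "{f\<in>space (PiM {1..m} (\<lambda>_. borel)). R f}"]) (auto simp: pred_def)

lemma past_event_S:
  assumes "j \<le> m"
  shows "past_event m (\<lambda>\<omega>. S j \<omega> > c)"
proof (rule past_eventI[where R="\<lambda>f. (\<Sum>i=1..j. f i) > c"])
  have [measurable]: "(\<lambda>f. \<Sum>i=1..j. f i) \<in> borel_measurable (PiM {1..m} (\<lambda>_. borel :: real measure))"
    using assms by (intro borel_measurable_sum measurable_component_singleton) auto
  show "Measurable.pred (PiM {1..m} (\<lambda>_. borel)) (\<lambda>f. c < (\<Sum>i=1..j. f i))" by measurable
  show "c < S j \<omega> \<longleftrightarrow> c < (\<Sum>i=1..j. past m \<omega> i)" for \<omega>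
    using assms by (simp add: partial_sum_def past_def)
qed

lemma past_event_conj:
  assumes "past_event m E" "past_event m F"
  shows "past_event m (\<lambda>\<omega>. E \<omega> \<and> F \<omega>)"
proof -
  obtain A B where "A \<in> sets (PiM {1..m} (\<lambda>_. borel))" "\<forall>\<omega>\<in>space P. E \<omega> \<longleftrightarrow> past m \<omega> \<in> A"
    "B \<in> sets (PiM {1..m} (\<lambda>_. borel))" "\<forall>\<omega>\<in>space P. F \<omega> \<longleftrightarrow> past m \<omega> \<in> B"
    using assms by (auto simp: past_event_def)
  then show ?thesis unfolding past_event_def by (intro bexI[of _ "A \<inter> B"]) auto
qed

lemma past_event_not:
  assumes "past_event m E"
  shows "past_event m (\<lambda>\<omega>. \<not> E \<omega>)"
proof -
  obtain A where "A \<in> sets (PiM {1..m} (\<lambda>_. borel))" "\<forall>\<omega>\<in>space P. E \<omega> \<longleftrightarrow> past m \<omega> \<in> A"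
    using assms by (auto simp: past_event_def)
  then show ?thesis unfolding past_event_def
    using measurable_space[OF measurable_past[of m]]
    by (intro bexI[of _ "space (PiM {1..m} (\<lambda>_. borel)) - A"]) auto
qed

lemma past_event_ball_less:
  fixes k :: nat
  assumes "\<And>j. j < k \<Longrightarrow> past_event m (E j)"
  shows "past_event m (\<lambda>\<omega>. \<forall>j<k. E j \<omega>)"
  using assms
proof (induction k)
  case 0
  show ?case by (rule past_eventI[where R="\<lambda>_. True"]) auto
next
  case (Suc k)
  have "past_event m (\<lambda>\<omega>. (\<forall>j<k. E j \<omega>) \<and> E k \<omega>)"
    by (intro past_event_conj Suc) auto
  moreover have "(\<lambda>\<omega>. (\<forall>j<k. E j \<omega>) \<and> E k \<omega>) = (\<lambda>\<omega>. \<forall>j<Suc k. E j \<omega>)"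
    by (auto simp: less_Suc_eq)
  ultimately show ?case by simp
qed

lemma past_event_sets:
  assumes "past_event m E"
  shows "{\<omega>\<in>space P. E \<omega>} \<in> events"
proof -
  obtain A where A: "A \<in> sets (PiM {1..m} (\<lambda>_. borel))" "\<forall>\<omega>\<in>space P. E \<omega> \<longleftrightarrow> past m \<omega> \<in> A"
    using assms by (auto simp: past_event_def)
  have "{\<omega>\<in>space P. E \<omega>} = past m -` A \<inter> space P" using A(2) by auto
  then show ?thesis using measurable_sets[OF measurable_past A(1)] by simp
qed

lemma nn_integral_past_event:
  assumes E: "past_event m E"
    and g [measurable]: "g \<in> borel_measurable (PiM {1..} (\<lambda>_. borel))"
  shows "(\<integral>\<^sup>+\<omega>. indicator {\<omega>. E \<omega>} \<omega> * g (future m \<omega>) \<partial>P)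
    = emeasure P {\<omega>\<in>space P. E \<omega>} * (\<integral>\<^sup>+\<omega>. g (future 0 \<omega>) \<partial>P)"
proof -
  obtain A where A: "A \<in> sets (PiM {1..m} (\<lambda>_. borel))" "\<forall>\<omega>\<in>space P. E \<omega> \<longleftrightarrow> past m \<omega> \<in> A"
    using E by (auto simp: past_event_def)
  have "(\<integral>\<^sup>+\<omega>. indicator {\<omega>. E \<omega>} \<omega> * g (future m \<omega>) \<partial>P)
      = (\<integral>\<^sup>+\<omega>. indicator A (past m \<omega>) * g (future m \<omega>) \<partial>P)"
    using A(2) by (intro nn_integral_cong) (auto simp: indicator_def)
  also have "\<dots> = emeasure P {\<omega>\<in>space P. past m \<omega> \<in> A} * (\<integral>\<^sup>+\<omega>. g (future 0 \<omega>) \<partial>P)"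
    by (rule nn_integral_past_future[OF A(1) g])
  also have "{\<omega>\<in>space P. past m \<omega> \<in> A} = {\<omega>\<in>space P. E \<omega>}" using A(2) by auto
  finally show ?thesis .
qed

section \<open>The Markov property for the next step and at stopping times\<close>

lemma nn_integral_next_step:
  assumes E: "past_event m E" and h [measurable]: "h \<in> borel_measurable borel"
  shows "(\<integral>\<^sup>+\<omega>. indicator {\<omega>. E \<omega>} \<omega> * h (Xs (Suc m) \<omega>) \<partial>P)
    = emeasure P {\<omega>\<in>space P. E \<omega>} * (\<integral>\<^sup>+\<omega>. h (X \<omega>) \<partial>P)"
proof -
  have [measurable]: "(\<lambda>f. f (1::nat)) \<in> measurable (PiM {1..} (\<lambda>_. borel)) (borel :: real measure)"
    by (intro measurable_component_singleton) simp
  have [measurable]: "Xs 1 \<in> borel_measurable P" by (rule rv_Xs) simp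
  have "(\<integral>\<^sup>+\<omega>. h (Xs 1 \<omega>) \<partial>P) = (\<integral>\<^sup>+x. h x \<partial>distr P borel (Xs 1))"
    by (subst nn_integral_distr) auto
  also have "\<dots> = (\<integral>\<^sup>+\<omega>. h (X \<omega>) \<partial>P)"
    by (subst ident) (auto simp: nn_integral_distr)
  finally have "(\<integral>\<^sup>+\<omega>. h (Xs 1 \<omega>) \<partial>P) = (\<integral>\<^sup>+\<omega>. h (X \<omega>) \<partial>P)" .
  then show ?thesis
    using nn_integral_past_event[OF E, of "\<lambda>f. h (f 1)"] by (simp add: future_def Suc_eq_plus1)
qed

lemma emeasure_next_step:
  assumes E: "past_event m E"
  shows "emeasure P {\<omega>\<in>space P. E \<omega> \<and> Xs (Suc m) \<omega> > y}
    = emeasure P {\<omega>\<in>space P. E \<omega>} * emeasure P {\<omega>\<in>space P. X \<omega> > y}"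
proof -
  have [measurable]: "Xs (Suc m) \<in> borel_measurable P" by (rule rv_Xs) simp
  have [measurable]: "{\<omega>\<in>space P. E \<omega>} \<in> events" by (rule past_event_sets[OF E])
  have "(\<integral>\<^sup>+\<omega>. indicator {\<omega>. E \<omega>} \<omega> * indicator {y<..} (Xs (Suc m) \<omega>) \<partial>P)
    = (\<integral>\<^sup>+\<omega>. indicator {\<omega>\<in>space P. E \<omega> \<and> Xs (Suc m) \<omega> > y} \<omega> \<partial>P)"
    by (intro nn_integral_cong) (auto simp: indicator_def)
  also have "\<dots> = emeasure P {\<omega>\<in>space P. E \<omega> \<and> Xs (Suc m) \<omega> > y}"
    by (intro nn_integral_indicator) measurable
  finally have 1: "(\<integral>\<^sup>+\<omega>. indicator {\<omega>. E \<omega>} \<omega> * indicator {y<..} (Xs (Suc m) \<omega>) \<partial>P)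
    = emeasure P {\<omega>\<in>space P. E \<omega> \<and> Xs (Suc m) \<omega> > y}" .
  have "(\<integral>\<^sup>+\<omega>. indicator {y<..} (X \<omega>) \<partial>P) = (\<integral>\<^sup>+\<omega>. indicator {\<omega>\<in>space P. X \<omega> > y} \<omega> \<partial>P)"
    by (intro nn_integral_cong) (auto simp: indicator_def)
  also have "\<dots> = emeasure P {\<omega>\<in>space P. X \<omega> > y}"
    by (intro nn_integral_indicator) measurable
  finally show ?thesis using nn_integral_next_step[OF E, of "indicator {y<..}"] 1 by simp
qed

text \<open>The increments after time \<open>m\<close> are the partial sums of
  \<open>future m\<close>, so the climb is a measurable event of the future. The set
  \<open>K\<close> of admissible durations is later either \<open>UNIV\<close> or a finite
  horizon.\<close>

lemma emeasure_restart:
  assumes E: "past_event m E"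
  shows "emeasure P {\<omega>\<in>space P. E \<omega> \<and> (\<exists>k\<in>K. S (m + k) \<omega> - S m \<omega> > y)}
    = emeasure P {\<omega>\<in>space P. E \<omega>} * emeasure P {\<omega>\<in>space P. \<exists>k\<in>K. S k \<omega> > y}"
proof -
  let ?T = "PiM {1..} (\<lambda>_::nat. borel :: real measure)"
  have [measurable]: "(\<lambda>f. \<Sum>i=1..k. f i) \<in> borel_measurable ?T" for k
    by (intro borel_measurable_sum measurable_component_singleton) auto
  have [measurable]: "{\<omega>\<in>space P. E \<omega>} \<in> events" by (rule past_event_sets[OF E])
  define G where "G = {f\<in>space ?T. \<exists>k\<in>K. (\<Sum>i=1..k. f i) > y}"
  have G [measurable]: "G \<in> sets ?T" unfolding G_def by measurable
  have fut: "future n \<omega> \<in> G \<longleftrightarrow> (\<exists>k\<in>K. S (n + k) \<omega> - S n \<omega> > y)" if "\<omega> \<in> space P" for n \<omega>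
  proof -
    have "future n \<omega> \<in> space ?T" using measurable_space[OF measurable_future that] .
    moreover have "(\<Sum>i=1..k. future n \<omega> i) = S (n + k) \<omega> - S n \<omega>" for k
      unfolding S_add by (intro sum.cong) (auto simp: future_def)
    ultimately show ?thesis by (simp add: G_def)
  qed
  have "(\<integral>\<^sup>+\<omega>. indicator {\<omega>. E \<omega>} \<omega> * indicator G (future m \<omega>) \<partial>P)
    = (\<integral>\<^sup>+\<omega>. indicator {\<omega>\<in>space P. E \<omega> \<and> (\<exists>k\<in>K. S (m + k) \<omega> - S m \<omega> > y)} \<omega> \<partial>P)"
    using fut by (intro nn_integral_cong) (auto simp: indicator_def)
  also have "\<dots> = emeasure P {\<omega>\<in>space P. E \<omega> \<and> (\<exists>k\<in>K. S (m + k) \<omega> - S m \<omega> > y)}"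
    by (intro nn_integral_indicator) measurable
  finally have 1: "(\<integral>\<^sup>+\<omega>. indicator {\<omega>. E \<omega>} \<omega> * indicator G (future m \<omega>) \<partial>P)
    = emeasure P {\<omega>\<in>space P. E \<omega> \<and> (\<exists>k\<in>K. S (m + k) \<omega> - S m \<omega> > y)}" .
  have "(\<integral>\<^sup>+\<omega>. indicator G (future 0 \<omega>) \<partial>P) = (\<integral>\<^sup>+\<omega>. indicator {\<omega>\<in>space P. \<exists>k\<in>K. S k \<omega> > y} \<omega> \<partial>P)"
    using fut[of _ 0] by (intro nn_integral_cong) (auto simp: indicator_def partial_sum_def)
  also have "\<dots> = emeasure P {\<omega>\<in>space P. \<exists>k\<in>K. S k \<omega> > y}"
    by (intro nn_integral_indicator) measurable
  finally show ?thesis using nn_integral_past_event[OF E, of "indicator G"] 1 by simp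
qed

text \<open>A strong Markov property: \<open>E m\<close> stands for a stopping time being equal to
  \<open>m\<close>. Disjointness makes the probabilities of the \<open>E m\<close> add up to that of
  stopping at all; a union bound handles the left-hand side.\<close>

lemma prob_restart_le:
  assumes E: "\<And>k. past_event k (E k)"
    and disj: "\<And>k l \<omega>. E k \<omega> \<Longrightarrow> E l \<omega> \<Longrightarrow> k = l"
  shows "prob {\<omega>\<in>space P. \<exists>m. E m \<omega> \<and> (\<exists>k\<in>K. S (m + k) \<omega> - S m \<omega> > y)}
    \<le> prob {\<omega>\<in>space P. \<exists>m. E m \<omega>} * prob {\<omega>\<in>space P. \<exists>k\<in>K. S k \<omega> > y}"
proof -
  have ev [measurable]: "{\<omega>\<in>space P. E m \<omega>} \<in> events" for m by (rule past_event_sets[OF E])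
  let ?F = "\<lambda>m. {\<omega>\<in>space P. E m \<omega> \<and> (\<exists>k\<in>K. S (m + k) \<omega> - S m \<omega> > y)}"
  let ?c = "emeasure P {\<omega>\<in>space P. \<exists>k\<in>K. S k \<omega> > y}"
  have F: "?F m \<in> events" for m by measurable
  have "emeasure P (\<Union>m. ?F m) \<le> (\<Sum>m. emeasure P (?F m))"
    using F by (intro emeasure_subadditive_countably) auto
  also have "\<dots> = (\<Sum>m. emeasure P {\<omega>\<in>space P. E m \<omega>}) * ?c"
    by (simp add: emeasure_restart[OF E] ennreal_suminf_multc)
  also have "(\<Sum>m. emeasure P {\<omega>\<in>space P. E m \<omega>}) = emeasure P (\<Union>m. {\<omega>\<in>space P. E m \<omega>})"
    using ev disj by (intro suminf_emeasure) (auto simp: disjoint_family_on_def)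
  finally have "emeasure P (\<Union>m. ?F m) \<le> emeasure P (\<Union>m. {\<omega>\<in>space P. E m \<omega>}) * ?c" .
  moreover have "(\<Union>m. ?F m) = {\<omega>\<in>space P. \<exists>m. E m \<omega> \<and> (\<exists>k\<in>K. S (m + k) \<omega> - S m \<omega> > y)}"
    "(\<Union>m. {\<omega>\<in>space P. E m \<omega>}) = {\<omega>\<in>space P. \<exists>m. E m \<omega>}" by auto
  ultimately show ?thesis
    by (simp add: emeasure_eq_measure ennreal_mult[symmetric])
qed

end

section \<open>Decomposition into cycles\<close>

text \<open>The number \<open>e\<close> is the mean passage time, written as the sum over
  \<open>n\<close> of the probabilities that the passage time exceeds \<open>n\<close>.\<close>

locale iid_walk_cycle = iid_walk P X Xs for P :: "'a measure" and X Xs +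
  fixes z e :: real
  assumes z_pos: "z > 0"
    and integrable_X: "integrable P X"
    and mean_cycle: "(\<lambda>n. prob {\<omega>\<in>space P. \<forall>j<Suc n. S j \<omega> > - z}) sums e"
begin

text \<open>Says that the passage time is at least \<open>k\<close>. Time \<open>k\<close> itself is
  left free, so for positive \<open>k\<close> the event depends on the first \<open>k - 1\<close>
  steps only and is independent of step \<open>k\<close>.\<close>

definition alive :: "nat \<Rightarrow> 'a \<Rightarrow> bool" where
  "alive k \<omega> \<longleftrightarrow> (\<forall>j<k. S j \<omega> > - z)"

definition tail :: "real \<Rightarrow> real" where
  "tail y = prob {\<omega>\<in>space P. X \<omega> > y}"

definition max_tail :: "real \<Rightarrow> real" where
  "max_tail y = prob {\<omega>\<in>space P. \<exists>k. S k \<omega> > y}"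

text \<open>For nonnegative \<open>y\<close>, a value \<open>S k \<omega> > y\<close> lies above
  \<open>- z\<close>, so \<open>k\<close> is then strictly before the passage time; this is the tail
  of the maximum over one cycle.\<close>

definition cycle_tail :: "real \<Rightarrow> real" where
  "cycle_tail y = prob {\<omega>\<in>space P. \<exists>k. alive k \<omega> \<and> S k \<omega> > y}"

lemma past_event_alive: "k \<le> Suc m \<Longrightarrow> past_event m (alive k)"
  unfolding alive_def[abs_def] by (intro past_event_ball_less past_event_S) auto

lemma measurable_alive [measurable]: "{\<omega>\<in>space P. alive k \<omega>} \<in> events"
  by (rule past_event_sets[of k]) (auto intro: past_event_alive)

lemma pred_alive [measurable]: "Measurable.pred P (alive k)"
  by (simp add: pred_def)

lemma rv_Xs_Suc [measurable]: "Xs (Suc n) \<in> borel_measurable P"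
  by (rule rv_Xs) simp

lemma mean_cycle': "(\<lambda>n. prob {\<omega>\<in>space P. alive (Suc n) \<omega>}) sums e"
  using mean_cycle by (simp add: alive_def)

lemma e_nonneg: "e \<ge> 0"
  by (rule sums_le[OF _ sums_zero mean_cycle]) simp

lemma cycle_tail_antimono:
  assumes "x \<le> y"
  shows "cycle_tail y \<le> cycle_tail x"
  unfolding cycle_tail_def
  by (rule finite_measure_mono) (auto intro: order.strict_trans1[OF assms])

lemma cycle_tail_nonneg: "cycle_tail x \<ge> 0"
  by (simp add: cycle_tail_def)

text \<open>Step \<open>n + 1\<close> is independent of survival through time \<open>n\<close>, and
  the survival probabilities sum to \<open>e\<close>. A union bound over the position of the jump
  concludes.\<close>

lemma prob_big_jump:
  "prob {\<omega>\<in>space P. \<exists>n. alive (Suc n) \<omega> \<and> Xs (Suc n) \<omega> > y} \<le> e * tail y"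
proof -
  let ?F = "\<lambda>n. {\<omega>\<in>space P. alive (Suc n) \<omega> \<and> Xs (Suc n) \<omega> > y}"
  have "emeasure P (?F n) = emeasure P {\<omega>\<in>space P. alive (Suc n) \<omega>} * emeasure P {\<omega>\<in>space P. X \<omega> > y}" for n
    by (rule emeasure_next_step[OF past_event_alive]) simp
  then have eq: "prob (?F n) = prob {\<omega>\<in>space P. alive (Suc n) \<omega>} * tail y" for n
    by (simp add: measure_def enn2real_mult tail_def)
  have sums: "(\<lambda>n. prob (?F n)) sums (e * tail y)"
    unfolding eq by (rule sums_mult2[OF mean_cycle'])
  have "prob (\<Union>n. ?F n) \<le> (\<Sum>n. prob (?F n))"
    using sums by (intro finite_measure_subadditive_countably) (auto simp: sums_iff)
  also have "\<dots> = e * tail y" using sums by (simp add: sums_iff)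
  also have "(\<Union>n. ?F n) = {\<omega>\<in>space P. \<exists>n. alive (Suc n) \<omega> \<and> Xs (Suc n) \<omega> > y}" by auto
  finally show ?thesis .
qed

text \<open>
  Either some step during the cycle exceeds \<open>t x\<close>, or the walk is at most \<open>(s + t) x\<close> when it
  first exceeds \<open>s x\<close> and still has to climb \<open>(1 - s - t) x\<close> afterwards.
\<close>

lemma cycle_tail_le:
  assumes "s > 0" "t > 0" "s + t < 1" "x > 0"
  shows "cycle_tail x \<le> e * tail (t * x) + cycle_tail (s * x) * max_tail ((1 - s - t) * x)"
proof -
  \<comment> \<open>\<open>E k\<close> makes \<open>k\<close> the first time above
    \<open>s * x\<close>, with that time inside the cycle.\<close>
  define E where "E k \<omega> \<longleftrightarrow> (alive k \<omega> \<and> S k \<omega> > s * x) \<and> (\<forall>j<k. \<not> S j \<omega> > s * x)" for k \<omega>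
  have E: "past_event k (E k)" for k
    unfolding E_def[abs_def]
    by (intro past_event_conj past_event_ball_less past_event_not past_event_S past_event_alive) auto
  have disj: "k = l" if "E k \<omega>" "E l \<omega>" for k l \<omega>
    using that unfolding E_def by (metis nat_neq_iff)
  have [measurable]: "Measurable.pred P (E k)" for k
    using past_event_sets[OF E] by (simp add: pred_def)
  let ?J = "{\<omega>\<in>space P. \<exists>n. alive (Suc n) \<omega> \<and> Xs (Suc n) \<omega> > t * x}"
  let ?R = "{\<omega>\<in>space P. \<exists>m. E m \<omega> \<and> (\<exists>k\<in>UNIV. S (m + k) \<omega> - S m \<omega> > (1 - s - t) * x)}"
  have "{\<omega>\<in>space P. \<exists>k. alive k \<omega> \<and> S k \<omega> > x} \<subseteq> ?J \<union> ?R"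
  proof safe
    fix \<omega> k
    assume \<omega>: "\<omega> \<in> space P" "alive k \<omega>" "S k \<omega> > x"
      and no_climb: "\<not> (\<exists>m. E m \<omega> \<and> (\<exists>k\<in>UNIV. S (m + k) \<omega> - S m \<omega> > (1 - s - t) * x))"
    have "s * x \<le> 1 * x" using assms by (intro mult_right_mono) auto
    then have "S k \<omega> > s * x" using \<omega> by simp
    then obtain m where m: "S m \<omega> > s * x" "\<forall>j<m. \<not> S j \<omega> > s * x" "m \<le> k"
      using exists_least_iff[of "\<lambda>m. S m \<omega> > s * x"] by (metis not_le)
    then have "E m \<omega>" using \<omega>(2) by (auto simp: E_def alive_def)
    then have "\<not> S (m + (k - m)) \<omega> - S m \<omega> > (1 - s - t) * x" using no_climb by blast
    then have Sm: "S m \<omega> > (s + t) * x" using m(3) \<omega>(3) by (simp add: algebra_simps)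
    \<comment> \<open>The walk starts at 0, below \<open>s * x\<close>, so the first crossing is
      made by an actual step, which must span the gap from \<open>s * x\<close> to
      \<open>(s + t) * x\<close>.\<close>
    have "s * x > 0" using assms by simp
    then have "m \<noteq> 0" using m(1) by (intro notI) (simp add: partial_sum_def)
    then obtain n where n: "m = Suc n" by (cases m) auto
    have "S n \<omega> \<le> s * x" using m(2) n by auto
    moreover have "S m \<omega> = S n \<omega> + Xs (Suc n) \<omega>" by (simp add: n partial_sum_def)
    ultimately have "Xs (Suc n) \<omega> > t * x" using Sm by (simp add: algebra_simps)
    moreover have "alive (Suc n) \<omega>" using \<open>E m \<omega>\<close> n by (simp add: E_def)
    ultimately show "\<exists>n. alive (Suc n) \<omega> \<and> Xs (Suc n) \<omega> > t * x" by blast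
  qed
  then have "cycle_tail x \<le> prob (?J \<union> ?R)"
    unfolding cycle_tail_def by (intro finite_measure_mono) auto
  also have "\<dots> \<le> prob ?J + prob ?R"
    by (rule measure_Un_le) measurable
  also have "prob ?R \<le> prob {\<omega>\<in>space P. \<exists>m. E m \<omega>} * prob {\<omega>\<in>space P. \<exists>k\<in>UNIV. S k \<omega> > (1 - s - t) * x}"
    by (rule prob_restart_le[OF E disj])
  also have "prob {\<omega>\<in>space P. \<exists>m. E m \<omega>} \<le> cycle_tail (s * x)"
    unfolding cycle_tail_def by (intro finite_measure_mono) (auto simp: E_def)
  also have "prob {\<omega>\<in>space P. \<exists>k\<in>UNIV. S k \<omega> > (1 - s - t) * x} = max_tail ((1 - s - t) * x)"
    by (simp add: max_tail_def)
  finally show ?thesis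
    using prob_big_jump[of "t * x"] by (simp add: mult_right_mono max_tail_def)
qed

text \<open>If \<open>x\<close> is not exceeded within the first cycle, the walk restarts from a
  value at most \<open>- z\<close> and must climb more than \<open>x + z\<close> in at most
  \<open>N\<close> further steps. The finite horizon is what makes the remainder vanish under
  iteration.\<close>

lemma prob_max_le_cycle:
  assumes "x \<ge> 0"
  shows "prob {\<omega>\<in>space P. \<exists>k\<in>{..N}. S k \<omega> > x}
    \<le> cycle_tail x + prob {\<omega>\<in>space P. \<exists>k\<in>{..N}. S k \<omega> > x + z}"
proof -
  \<comment> \<open>\<open>F k\<close> says that the passage time is exactly
    \<open>k\<close>.\<close>
  define F where "F k \<omega> \<longleftrightarrow> alive k \<omega> \<and> \<not> S k \<omega> > - z" for k \<omega>
  have F: "past_event k (F k)" for k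
    unfolding F_def[abs_def]
    by (intro past_event_conj past_event_not past_event_S past_event_alive) auto
  have disj: "k = l" if "F k \<omega>" "F l \<omega>" for k l \<omega>
    using that unfolding F_def alive_def by (metis nat_neq_iff)
  have [measurable]: "Measurable.pred P (F k)" for k
    using past_event_sets[OF F] by (simp add: pred_def)
  let ?Q = "{\<omega>\<in>space P. \<exists>k. alive k \<omega> \<and> S k \<omega> > x}"
  let ?R = "{\<omega>\<in>space P. \<exists>m. F m \<omega> \<and> (\<exists>k\<in>{..N}. S (m + k) \<omega> - S m \<omega> > x + z)}"
  have "{\<omega>\<in>space P. \<exists>k\<in>{..N}. S k \<omega> > x} \<subseteq> ?Q \<union> ?R"
  proof safe
    fix \<omega> k
    assume \<omega>: "\<omega> \<in> space P" "k \<le> N" "S k \<omega> > x"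
      and no_climb: "\<not> (\<exists>m. F m \<omega> \<and> (\<exists>k\<in>{..N}. S (m + k) \<omega> - S m \<omega> > x + z))"
    have "alive k \<omega>"
    proof (rule ccontr)
      assume "\<not> alive k \<omega>"
      then obtain m where m: "m < k" "\<not> S m \<omega> > - z" "\<forall>j<m. S j \<omega> > - z"
        using exists_least_iff[of "\<lambda>m. \<not> S m \<omega> > - z"] unfolding alive_def
        by (metis linorder_neqE_nat order.strict_trans)
      then have "F m \<omega>" by (simp add: F_def alive_def)
      moreover have "S (m + (k - m)) \<omega> - S m \<omega> > x + z" using m \<omega> by simp
      moreover have "k - m \<in> {..N}" using \<omega> by simp
      ultimately show False using no_climb by blast
    qed
    then show "\<exists>k. alive k \<omega> \<and> S k \<omega> > x" using \<omega> by blast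
  qed
  then have "prob {\<omega>\<in>space P. \<exists>k\<in>{..N}. S k \<omega> > x} \<le> prob (?Q \<union> ?R)"
    by (intro finite_measure_mono) auto
  also have "\<dots> \<le> prob ?Q + prob ?R"
    by (rule measure_Un_le) measurable
  also have "prob ?R \<le> prob {\<omega>\<in>space P. \<exists>m. F m \<omega>} * prob {\<omega>\<in>space P. \<exists>k\<in>{..N}. S k \<omega> > x + z}"
    by (rule prob_restart_le[OF F disj])
  also have "\<dots> \<le> 1 * prob {\<omega>\<in>space P. \<exists>k\<in>{..N}. S k \<omega> > x + z}"
    by (intro mult_right_mono prob_le_1) simp
  finally show ?thesis by (simp add: cycle_tail_def)
qed

text \<open>The sum counts, in mean, the multiples of \<open>z\<close> below the cycle maximum. That
  maximum is dominated by \<open>W\<close>, the sum of the positive parts of the steps in the cycle,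
  and as in Wald's identity \<open>W\<close> has the finite mean \<open>e * c\<close>, where
  \<open>c\<close> is the mean positive part of \<open>X\<close>.\<close>

lemma summable_cycle_tail_multiples: "summable (\<lambda>j. cycle_tail (real (Suc j) * z))"
proof -
  \<comment> \<open>Since \<open>ennreal\<close> sends negative reals to 0, each step enters through
    its positive part.\<close>
  define W where "W \<omega> = (\<Sum>n. indicator {\<omega>. alive (Suc n) \<omega>} \<omega> * ennreal (Xs (Suc n) \<omega>))" for \<omega>
  define Q where "Q j \<omega> \<longleftrightarrow> (\<exists>k. alive k \<omega> \<and> S k \<omega> > real (Suc j) * z)" for j \<omega>
  define c where "c = enn2real (\<integral>\<^sup>+\<omega>. ennreal (X \<omega>) \<partial>P)"
  have [measurable]: "Measurable.pred P (Q j)" for j unfolding Q_def by measurable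
  have "(\<integral>\<^sup>+\<omega>. ennreal (X \<omega>) \<partial>P) \<le> (\<integral>\<^sup>+\<omega>. ennreal (norm (X \<omega>)) \<partial>P)"
    by (intro nn_integral_mono) (auto intro: ennreal_leI)
  also have "\<dots> < \<infinity>" using integrable_X by (simp add: integrable_iff_bounded)
  finally have c: "(\<integral>\<^sup>+\<omega>. ennreal (X \<omega>) \<partial>P) = ennreal c" by (simp add: c_def)
  have c0: "c \<ge> 0" by (simp add: c_def)
  have step: "(\<integral>\<^sup>+\<omega>. indicator {\<omega>. alive (Suc n) \<omega>} \<omega> * ennreal (Xs (Suc n) \<omega>) \<partial>P)
      = emeasure P {\<omega>\<in>space P. alive (Suc n) \<omega>} * ennreal c" for n
    unfolding c[symmetric] by (intro nn_integral_next_step past_event_alive) auto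
  have "(\<integral>\<^sup>+\<omega>. W \<omega> \<partial>P) = (\<Sum>n. emeasure P {\<omega>\<in>space P. alive (Suc n) \<omega>} * ennreal c)"
    unfolding W_def step[symmetric] by (rule nn_integral_suminf) measurable
  also have "\<dots> = (\<Sum>n. ennreal (prob {\<omega>\<in>space P. alive (Suc n) \<omega>})) * ennreal c"
    by (simp add: emeasure_eq_measure)
  also have "(\<Sum>n. ennreal (prob {\<omega>\<in>space P. alive (Suc n) \<omega>})) = ennreal e"
    using mean_cycle' by (intro suminf_ennreal_eq) auto
  finally have W: "(\<integral>\<^sup>+\<omega>. W \<omega> \<partial>P) = ennreal (e * c)"
    using e_nonneg c0 by (simp add: ennreal_mult)
  have le_W: "ennreal y \<le> W \<omega>" if "alive k \<omega>" "S k \<omega> > y" for k \<omega> y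
  proof -
    have "S k \<omega> = (\<Sum>n<k. Xs (Suc n) \<omega>)"
      unfolding partial_sum_def
      by (rule sum.reindex_bij_witness[of _ Suc "\<lambda>i. i - 1"]) auto
    also have "\<dots> \<le> (\<Sum>n<k. max 0 (Xs (Suc n) \<omega>))" by (intro sum_mono) auto
    finally have "ennreal y \<le> ennreal (\<Sum>n<k. max 0 (Xs (Suc n) \<omega>))"
      using that by (intro ennreal_leI) auto
    also have "\<dots> = (\<Sum>n<k. indicator {\<omega>. alive (Suc n) \<omega>} \<omega> * ennreal (Xs (Suc n) \<omega>))"
      using that(1) by (subst sum_ennreal[symmetric]) (auto intro!: sum.cong simp: alive_def ennreal_max_0)
    also have "\<dots> \<le> W \<omega>" unfolding W_def by (rule sum_le_suminf) auto
    finally show ?thesis .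
  qed
  \<comment> \<open>If the level \<open>(N + 1) * z\<close> is exceeded, \<open>W\<close> is at
    least that level, which pays for all \<open>N + 1\<close> terms at once; otherwise the new term
    is 0.\<close>
  have Q_W: "(\<Sum>j<N. ennreal z * indicator {\<omega>\<in>space P. Q j \<omega>} \<omega>) \<le> W \<omega>" for N \<omega>
  proof (induction N)
    case (Suc N)
    show ?case
    proof (cases "\<omega> \<in> space P \<and> Q N \<omega>")
      case True
      then obtain k where k: "alive k \<omega>" "S k \<omega> > real (Suc N) * z" by (auto simp: Q_def)
      have "(\<Sum>j<Suc N. ennreal z * indicator {\<omega>\<in>space P. Q j \<omega>} \<omega>) \<le> (\<Sum>j<Suc N. ennreal z)"
        by (intro sum_mono) (auto simp: indicator_def)
      also have "\<dots> = ennreal (real (Suc N) * z)"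
        using z_pos by (simp add: ennreal_mult ennreal_of_nat_eq_real_of_nat del: of_nat_Suc)
      also have "\<dots> \<le> W \<omega>" by (rule le_W[OF k])
      finally show ?thesis .
    next
      case False
      then show ?thesis using Suc by simp
    qed
  qed simp
  have "(\<Sum>j<N. cycle_tail (real (Suc j) * z)) \<le> e * c / z" for N
  proof -
    have "ennreal (\<Sum>j<N. z * cycle_tail (real (Suc j) * z)) = (\<Sum>j<N. ennreal z * emeasure P {\<omega>\<in>space P. Q j \<omega>})"
      using z_pos by (subst sum_ennreal[symmetric])
        (auto simp: cycle_tail_def Q_def emeasure_eq_measure ennreal_mult simp del: of_nat_Suc)
    also have "\<dots> = (\<integral>\<^sup>+\<omega>. (\<Sum>j<N. ennreal z * indicator {\<omega>\<in>space P. Q j \<omega>} \<omega>) \<partial>P)"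
      by (subst nn_integral_sum) (auto simp: nn_integral_cmult)
    also have "\<dots> \<le> (\<integral>\<^sup>+\<omega>. W \<omega> \<partial>P)" by (intro nn_integral_mono Q_W)
    finally have "(\<Sum>j<N. z * cycle_tail (real (Suc j) * z)) \<le> e * c"
      using W e_nonneg c0 by simp
    then show ?thesis using z_pos by (simp add: sum_distrib_left[symmetric] field_simps)
  qed
  then show ?thesis by (intro summableI_nonneg_bounded) (auto intro: cycle_tail_nonneg)
qed

section \<open>Summation over successive cycles\<close>

lemma summable_cycle_tail:
  assumes "x \<ge> 0"
  shows "summable (\<lambda>j. cycle_tail (x + real j * z))"
proof -
  have "summable (\<lambda>j. cycle_tail (x + real (Suc j) * z))"
    using assms cycle_tail_nonneg
    by (intro summable_comparison_test_ev[OF _ summable_cycle_tail_multiples] always_eventually)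
      (auto intro!: cycle_tail_antimono simp del: of_nat_Suc)
  then show ?thesis by (subst (asm) summable_Suc_iff)
qed

lemma prob_max_le_sum_cycle:
  assumes "x \<ge> 0"
  shows "prob {\<omega>\<in>space P. \<exists>k\<in>{..N}. S k \<omega> > x}
    \<le> (\<Sum>j<n. cycle_tail (x + real j * z)) + prob {\<omega>\<in>space P. \<exists>k\<in>{..N}. S k \<omega> > x + real n * z}"
proof (induction n)
  case (Suc n)
  have "x + real n * z \<ge> 0" using assms z_pos by simp
  from prob_max_le_cycle[OF this, of N] Suc show ?case by (simp add: algebra_simps)
qed simp

text \<open>Two limits in this order: for a fixed horizon \<open>N\<close> the level
  \<open>x + n * z\<close> eventually passes the maximum of finitely many partial sums, which
  removes the remainder as \<open>n\<close> grows; then \<open>N\<close> tends to infinity by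
  continuity from below.\<close>

lemma max_tail_le:
  assumes "x \<ge> 0"
  shows "max_tail x \<le> (\<Sum>j. cycle_tail (x + real j * z))"
proof -
  let ?s = "\<Sum>j. cycle_tail (x + real j * z)"
  have "prob {\<omega>\<in>space P. \<exists>k\<in>{..N}. S k \<omega> > x} \<le> ?s" for N
  proof -
    let ?M = "\<lambda>n. {\<omega>\<in>space P. \<exists>k\<in>{..N}. S k \<omega> > x + real n * z}"
    have "\<exists>n. \<omega> \<notin> ?M n" for \<omega>
    proof -
      obtain n where n: "Max ((\<lambda>k. S k \<omega>) ` {..N}) - x < real n * z"
        using reals_Archimedean3[OF z_pos] by blast
      have "S k \<omega> \<le> x + real n * z" if "k \<le> N" for k
      proof -
        have "S k \<omega> \<le> Max ((\<lambda>k. S k \<omega>) ` {..N})" using that by (intro Max_ge) auto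
        with n show ?thesis by linarith
      qed
      then show ?thesis by (intro exI[of _ n]) (auto simp: not_less)
    qed
    then have empty: "(\<Inter>n. ?M n) = {}" by blast
    have "decseq ?M"
    proof (rule decseq_SucI)
      fix n
      have le: "x + real n * z \<le> x + real (Suc n) * z" using z_pos by (simp add: mult_right_mono)
      show "?M (Suc n) \<subseteq> ?M n" by (auto intro: order.strict_trans1[OF le] simp del: of_nat_Suc)
    qed
    moreover have "range ?M \<subseteq> events" by auto
    ultimately have "(\<lambda>n. prob (?M n)) \<longlonglongrightarrow> prob (\<Inter>n. ?M n)"
      by (intro finite_Lim_measure_decseq)
    then have lim: "(\<lambda>n. prob (?M n)) \<longlonglongrightarrow> 0" unfolding empty by simp
    have "(\<lambda>n. ?s + prob (?M n)) \<longlonglongrightarrow> ?s + 0" by (intro tendsto_intros lim)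
    moreover have "prob {\<omega>\<in>space P. \<exists>k\<in>{..N}. S k \<omega> > x} \<le> ?s + prob (?M n)" for n
      using prob_max_le_sum_cycle[OF assms, of N n]
        sum_le_suminf[OF summable_cycle_tail[OF assms], of "{..<n}"]
      by (auto simp: cycle_tail_nonneg)
    ultimately show ?thesis by (intro LIMSEQ_le_const) auto
  qed
  moreover have "(\<lambda>N. prob {\<omega>\<in>space P. \<exists>k\<in>{..N}. S k \<omega> > x})
      \<longlonglongrightarrow> prob (\<Union>N. {\<omega>\<in>space P. \<exists>k\<in>{..N}. S k \<omega> > x})"
    by (intro finite_Lim_measure_incseq) (auto simp: incseq_def intro: order_trans)
  moreover have "(\<Union>N. {\<omega>\<in>space P. \<exists>k\<in>{..N}. S k \<omega> > x}) = {\<omega>\<in>space P. \<exists>k. S k \<omega> > x}" by auto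
  ultimately show ?thesis
    unfolding max_tail_def by (intro LIMSEQ_le_const2[where a="?s"]) auto
qed

text \<open>Once \<open>x \<ge> N * z\<close>, the series in \<open>max_tail_le\<close> is dominated
  termwise by the remainder after \<open>N\<close> terms of one convergent series.\<close>

lemma max_tail_tendsto_0: "(max_tail \<longlongrightarrow> 0) at_top"
proof (rule tendstoI)
  fix d :: real assume "d > 0"
  have sm: "summable (\<lambda>j. cycle_tail (real j * z))" using summable_cycle_tail[of 0] by simp
  obtain N where N: "norm (\<Sum>j. cycle_tail (real (j + N) * z)) < d"
    using suminf_exist_split[OF \<open>d > 0\<close> sm] by blast
  have "max_tail x < d" if "x \<ge> real N * z" for x
  proof -
    have x: "x \<ge> 0" using that z_pos by (meson mult_nonneg_nonneg of_nat_0_le_iff order_less_imp_le order_trans)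
    have "max_tail x \<le> (\<Sum>j. cycle_tail (x + real j * z))" by (rule max_tail_le[OF x])
    also have "\<dots> \<le> (\<Sum>j. cycle_tail (real (j + N) * z))"
      using that sm
      by (intro suminf_le summable_cycle_tail x cycle_tail_antimono summable_ignore_initial_segment)
        (auto simp: algebra_simps)
    also have "\<dots> < d" using N by simp
    finally show ?thesis .
  qed
  then show "\<forall>\<^sub>F x in at_top. dist (max_tail x) 0 < d"
    by (intro eventually_at_top_linorderI[of "real N * z"]) (auto simp: max_tail_def)
qed

end

section \<open>Tail estimates\<close>

text \<open>Here \<open>q\<close>, \<open>T\<close>, \<open>m\<close> stand for
  \<open>cycle_tail\<close>, \<open>tail\<close>, \<open>max_tail\<close>. A crude bound
  \<open>q x \<le> C * T x\<close> comes first; inserted into \<open>step\<close>, it makes the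
  product term negligible against \<open>T x\<close> because \<open>m\<close> vanishes, so only the
  jump term remains.\<close>

lemma iterated_tail_bound:
  fixes q T m :: "real \<Rightarrow> real"
  assumes e: "e \<ge> 0"
    and T_anti: "\<And>x y. x \<le> y \<Longrightarrow> T y \<le> T x" and T_pos: "\<And>x. T x > 0"
    and T_reg: "\<And>c. c > 0 \<Longrightarrow> ((\<lambda>x. T (c * x) / T x) \<longlongrightarrow> c powr (- r)) at_top"
    and q: "\<And>x. 0 \<le> q x" "\<And>x. q x \<le> 1"
    and m: "(m \<longlongrightarrow> 0) at_top" "\<And>x. 0 \<le> m x"
    and step: "\<And>s t x. s > 0 \<Longrightarrow> t > 0 \<Longrightarrow> s + t < 1 \<Longrightarrow> x > 0 \<Longrightarrow>
      q x \<le> e * T (t * x) + q (s * x) * m ((1 - s - t) * x)"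
    and \<theta>: "0 < \<theta>" "\<theta> < 1" and \<eta>: "\<eta> > 0"
  shows "\<forall>\<^sub>F x in at_top. q x \<le> (e * \<theta> powr (- r) + \<eta>) * T x"
proof -
  have m_scale: "((\<lambda>x. m (c * x)) \<longlongrightarrow> 0) at_top" if "c > 0" for c
    by (rule filterlim_compose[OF m(1)])
      (rule filterlim_tendsto_pos_mult_at_top[OF tendsto_const that filterlim_ident])
  obtain C where C: "C > 0" "\<And>x. x > 0 \<Longrightarrow> q x \<le> C * T x"
  proof -
    \<comment> \<open>\<open>K\<close> lies above the limit of \<open>T (x / 4) / T x\<close>. With
      \<open>m\<close> below \<open>1 / (2 * K)\<close>, the product term is then at most half of
      \<open>C * T x\<close>.\<close>
    define K where "K = (1/4) powr (- r) + 1"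
    have K: "K > 0" by (simp add: K_def add_pos_pos)
    have "\<forall>\<^sub>F x in at_top. T (1/4 * x) / T x < K"
      by (rule order_tendstoD[OF T_reg]) (auto simp: K_def)
    moreover have "\<forall>\<^sub>F x in at_top. m (1/2 * x) < 1 / (2 * K)"
      using K by (intro order_tendstoD[OF m_scale]) auto
    ultimately have "\<forall>\<^sub>F x in at_top. T (1/4 * x) / T x < K \<and> m (1/2 * x) < 1 / (2 * K)"
      by (rule eventually_conj)
    then obtain x0 where x0: "\<And>x. x \<ge> x0 \<Longrightarrow> T (1/4 * x) / T x < K \<and> m (1/2 * x) < 1 / (2 * K)"
      unfolding eventually_at_top_linorder by blast
    define x1 where "x1 = max 1 x0"
    have x1: "x1 \<ge> 1" "x1 \<ge> x0" by (auto simp: x1_def)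
    \<comment> \<open>The summand \<open>2 * e * K\<close> gives
      \<open>e * K + C / 2 \<le> C\<close> in the recursion; \<open>1 / T x1\<close> covers
      \<open>x \<le> x1\<close>, where \<open>q x \<le> 1\<close> and
      \<open>T x \<ge> T x1\<close>.\<close>
    define C where "C = 2 * e * K + 1 / T x1"
    have C: "C > 0" "C \<ge> 2 * e * K" using e K T_pos[of x1] by (auto simp: C_def add_nonneg_pos)
    \<comment> \<open>Induction over scales: dividing \<open>x\<close> by 4 lowers the exponent
      \<open>n\<close> by one.\<close>
    have bd: "q x \<le> C * T x" if "0 < x" "x \<le> 4 ^ n * x1" for x n
      using that
    proof (induction n arbitrary: x)
      case 0
      have "q x \<le> (1 / T x1) * T x1" using q(2) T_pos[of x1] by simp
      also have "\<dots> \<le> C * T x"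
        using 0 T_pos[of x1] T_pos[of x] e K T_anti[of x x1] by (intro mult_mono) (auto simp: C_def)
      finally show ?case .
    next
      case (Suc n)
      show ?case
      proof (cases "x \<le> x1")
        case True
        have "q x \<le> (1 / T x1) * T x1" using q(2) T_pos[of x1] by simp
        also have "\<dots> \<le> C * T x"
          using True T_pos[of x1] T_pos[of x] e K T_anti[of x x1] by (intro mult_mono) (auto simp: C_def)
        finally show ?thesis .
      next
        case False
        then have *: "T (1/4 * x) \<le> K * T x" "m (1/2 * x) \<le> 1 / (2 * K)"
          using x0[of x] x1 T_pos[of x] by (auto simp: field_simps)
        have "q x \<le> e * T (1/4 * x) + q (1/4 * x) * m (1/2 * x)"
          using step[of "1/4" "1/4" x] Suc.prems by simp
        also have "q (1/4 * x) \<le> C * T (1/4 * x)"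
          using Suc by (intro Suc.IH) auto
        also have "C * T (1/4 * x) * m (1/2 * x) \<le> C * T (1/4 * x) * (1 / (2 * K))"
          using * C T_pos[of "1/4 * x"] by (intro mult_left_mono) auto
        also have "e * T (1/4 * x) + C * T (1/4 * x) * (1 / (2 * K)) = (e + C / (2 * K)) * T (1/4 * x)"
          by (simp add: algebra_simps)
        also have "\<dots> \<le> (e + C / (2 * K)) * (K * T x)"
          using * e C K by (intro mult_left_mono) auto
        also have "\<dots> = (e * K + C / 2) * T x" using K by (simp add: field_simps)
        also have "\<dots> \<le> C * T x" using C T_pos[of x] by (intro mult_right_mono) auto
        finally show ?thesis using m(2) by (simp add: mult_right_mono)
      qed
    qed
    have "q x \<le> C * T x" if "x > 0" for x
    proof -
      obtain n where "x < 4 ^ n" using real_arch_pow[of 4 x] by auto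
      also have "(4::real) ^ n \<le> 4 ^ n * x1" using x1 by (simp add: mult_le_cancel_left1)
      finally show ?thesis by (intro bd[of x n] that) simp
    qed
    then show thesis using that C by blast
  qed
  \<comment> \<open>Splits \<open>1 - \<theta>\<close> evenly, so that \<open>q\<close> and
    \<open>m\<close> are both evaluated at \<open>s * x\<close>.\<close>
  define s where "s = (1 - \<theta>) / 2"
  have s: "s > 0" "1 - s - \<theta> = s" "s + \<theta> < 1" using \<theta> by (auto simp: s_def field_simps)
  have "((\<lambda>x. e * (T (\<theta> * x) / T x) + C * (T (s * x) / T x) * m (s * x))
      \<longlongrightarrow> e * \<theta> powr (- r) + C * s powr (- r) * 0) at_top"
    using \<theta> s by (intro tendsto_intros T_reg m_scale)
  then have "\<forall>\<^sub>F x in at_top. e * (T (\<theta> * x) / T x) + C * (T (s * x) / T x) * m (s * x)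
      < e * \<theta> powr (- r) + \<eta>"
    using \<eta> by (intro order_tendstoD) auto
  then show ?thesis
    using eventually_gt_at_top[of 0]
  proof eventually_elim
    case (elim x)
    have "q x \<le> e * T (\<theta> * x) + q (s * x) * m (s * x)"
      using step[of s \<theta> x] \<theta> s elim by simp
    also have "q (s * x) * m (s * x) \<le> C * T (s * x) * m (s * x)"
      using C(2)[of "s * x"] s elim m(2) by (intro mult_right_mono) auto
    also have "e * T (\<theta> * x) + C * T (s * x) * m (s * x)
        = (e * (T (\<theta> * x) / T x) + C * (T (s * x) / T x) * m (s * x)) * T x"
      using T_pos[of x] by (simp add: field_simps)
    also have "\<dots> \<le> (e * \<theta> powr (- r) + \<eta>) * T x"
      using elim T_pos[of x] by (intro mult_right_mono) auto
    finally show ?case by simp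
  qed
qed

section \<open>Sums against integrals of a decreasing function\<close>

context
  fixes T :: "real \<Rightarrow> real" and a :: real
  assumes anti: "\<And>x y. x \<le> y \<Longrightarrow> T y \<le> T x" and nonneg: "\<And>x. 0 \<le> T x"
    and int: "set_integrable lborel {a..} T"
begin

lemma integral_antimono_ge:
  assumes "a \<le> b" "b \<le> c"
  shows "(c - b) * T c \<le> (LBINT u:{b..<c}. T u)"
proof -
  have "(c - b) * T c = (LBINT u:{b..<c}. T c)"
    using assms by (simp add: set_lebesgue_integral_def)
  also have "\<dots> \<le> (LBINT u:{b..<c}. T u)"
  proof (rule set_integral_mono)
    show "set_integrable lborel {b..<c} (\<lambda>_. T c)" using assms by (simp add: set_integrable_def)
    show "set_integrable lborel {b..<c} T" using assms by (intro set_integrable_subset[OF int]) auto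
  qed (auto intro: anti)
  finally show ?thesis .
qed

lemma integral_segment_le:
  assumes "a \<le> b"
  shows "(LBINT u:{a..<b}. T u) \<le> (LBINT u:{a..}. T u)"
proof -
  have "(LBINT u:{a..<b} \<union> {b..}. T u) = (LBINT u:{a..<b}. T u) + (LBINT u:{b..}. T u)"
    using assms by (intro set_integral_Un set_integrable_subset[OF int]) auto
  moreover have "{a..<b} \<union> {b..} = {a..}" using assms by auto
  moreover have "(LBINT u:{b..}. T u) \<ge> 0"
    unfolding set_lebesgue_integral_def using nonneg by (intro integral_nonneg_AE) (auto simp: indicator_def)
  ultimately show ?thesis by simp
qed

text \<open>Every term but the first is the value at the right end of a block of length
  \<open>z\<close>, hence at most the average over that block. The first term has no block to its
  left and stays separate.\<close>

lemma sum_shift_le_integral: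
  assumes "z > 0"
  shows "(\<Sum>j<n. T (a + real j * z)) \<le> T a + (LBINT u:{a..}. T u) / z"
proof -
  have "z * (\<Sum>j<k. T (a + real (Suc j) * z)) \<le> (LBINT u:{a..<a + real k * z}. T u)" for k
  proof (induction k)
    case (Suc k)
    let ?b = "a + real k * z" and ?c = "a + real (Suc k) * z"
    have ord: "a \<le> ?b" "?b \<le> ?c" using assms by (auto simp: mult_right_mono)
    have "(LBINT u:{a..<?b} \<union> {?b..<?c}. T u) = (LBINT u:{a..<?b}. T u) + (LBINT u:{?b..<?c}. T u)"
      using ord by (intro set_integral_Un set_integrable_subset[OF int]) auto
    moreover have "{a..<?b} \<union> {?b..<?c} = {a..<?c}" using ord by (intro ivl_disj_un)
    moreover have "z * T ?c \<le> (LBINT u:{?b..<?c}. T u)"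
      using integral_antimono_ge[OF ord] by (simp add: algebra_simps)
    ultimately show ?case using Suc by (simp add: distrib_left del: of_nat_Suc)
  qed (simp add: set_lebesgue_integral_def)
  note * = order_trans[OF this integral_segment_le]
  show ?thesis
  proof (cases n)
    case 0
    have "(LBINT u:{a..}. T u) \<ge> 0" using *[of 0] by simp
    then show ?thesis using 0 nonneg[of a] assms by simp
  next
    case (Suc k)
    have "(\<Sum>j<k. T (a + real (Suc j) * z)) \<le> (LBINT u:{a..}. T u) / z"
      using *[of k] assms by (simp add: field_simps)
    then show ?thesis unfolding Suc sum.lessThan_Suc_shift by simp
  qed
qed

end

context iid_walk_cycle begin

lemma tail_antimono:
  assumes "x \<le> y"
  shows "tail y \<le> tail x"
  unfolding tail_def by (rule finite_measure_mono) (auto intro: order.strict_trans1[OF assms])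

text \<open>Summing \<open>cycle_tail \<le> c * tail\<close> along \<open>x + j * z\<close> gives at
  most \<open>c\<close> times \<open>tail x\<close> plus the integrated tail over \<open>z\<close>.
  Regular variation makes \<open>tail x\<close> of smaller order than the integrated tail, so only
  \<open>c / z\<close> survives.\<close>

lemma max_tail_asymptotic_le:
  assumes tail_pos: "\<And>x. tail x > 0"
    and tail_reg: "\<And>c. c > 0 \<Longrightarrow> ((\<lambda>x. tail (c * x) / tail x) \<longlongrightarrow> c powr (- r)) at_top"
    and \<theta>: "0 < \<theta>" "\<theta> < 1" and y: "y > e / z * \<theta> powr (- r)"
  shows "\<forall>\<^sub>F x in at_top. max_tail x / integrated_tail P X x < y"
proof -
  define d where "d = e / z * \<theta> powr (- r)"
  \<comment> \<open>Chosen to put \<open>c / z\<close> midway between \<open>d\<close> and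
    \<open>y\<close>.\<close>
  define \<eta> where "\<eta> = z * (y - d) / 2"
  define c where "c = e * \<theta> powr (- r) + \<eta>"
  define K where "K = (1/2) powr (- r) + 1"
  have d: "d < y" using y by (simp add: d_def)
  then have \<eta>: "\<eta> > 0" using z_pos by (simp add: \<eta>_def)
  have c: "c > 0" using \<eta> e_nonneg by (simp add: c_def add_nonneg_pos)
  have "c / z = d + (y - d) / 2"
    using z_pos by (simp add: c_def d_def \<eta>_def add_divide_distrib)
  then have cz: "c / z < y" using d by (simp add: field_simps)
  have y0: "y > 0" using y e_nonneg z_pos
    by (meson divide_nonneg_pos mult_nonneg_nonneg order_le_less_trans powr_ge_zero)
  have "\<forall>\<^sub>F x in at_top. cycle_tail x \<le> c * tail x"
    unfolding c_def
    by (rule iterated_tail_bound[where m=max_tail, OF e_nonneg tail_antimono tail_pos tail_reg _ _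
          max_tail_tendsto_0 _ cycle_tail_le \<theta> \<eta>])
      (auto simp: cycle_tail_def max_tail_def)
  then obtain x0 where x0: "\<And>x. x \<ge> x0 \<Longrightarrow> cycle_tail x \<le> c * tail x"
    unfolding eventually_at_top_linorder by blast
  have lim: "((\<lambda>x. c * (K / x + 1 / z)) \<longlongrightarrow> c * (0 + 1 / z)) at_top"
    by (intro tendsto_intros tendsto_divide_0[OF tendsto_const] filterlim_at_top_imp_at_infinity filterlim_ident)
  have "\<forall>\<^sub>F x in at_top. c * (K / x + 1 / z) < y"
    using cz by (intro order_tendstoD[OF lim]) auto
  \<comment> \<open>Regular variation with factor 1/2, taken at the argument \<open>2 * x\<close>,
    bounds \<open>tail x\<close> by \<open>K * tail (2 * x)\<close>.\<close>
  moreover have "\<forall>\<^sub>F x in at_top. tail (1/2 * (2 * x)) / tail (2 * x) < K"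
    by (rule eventually_compose_filterlim[where P="\<lambda>x. tail (1/2 * x) / tail x < K" and f="\<lambda>x. 2 * x",
        OF order_tendstoD(2)[OF tail_reg]])
      (auto simp: K_def intro!: filterlim_tendsto_pos_mult_at_top[OF tendsto_const] filterlim_ident)
  ultimately show ?thesis
    using eventually_gt_at_top[of 0] eventually_ge_at_top[of x0]
  proof eventually_elim
    case (elim x)
    have G: "integrated_tail P X x = (LBINT u:{x..}. tail u)"
      by (simp add: integrated_tail_def tail_def)
    show ?case
    proof (cases "set_integrable lborel {x..} tail")
      case False
      \<comment> \<open>Junk values: a non-integrable tail has integral 0, and division by 0 gives 0.\<close>
      then have "integrated_tail P X x = 0"
        by (simp add: G set_lebesgue_integral_def set_integrable_def not_integrable_integral_eq)
      then show ?thesis using y0 by simp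
    next
      case True
      note tail_int = tail_antimono less_imp_le[OF tail_pos] True
      let ?G = "integrated_tail P X x"
      \<comment> \<open>Keeps only the part of the integral from \<open>x\<close> to
        \<open>2 * x\<close>. It follows that \<open>tail x\<close> is at most \<open>K / x\<close>
        times the integrated tail, a vanishing fraction.\<close>
      have "x * tail (2 * x) \<le> ?G"
        using integral_antimono_ge[OF tail_int, of x "2 * x"] integral_segment_le[OF tail_int, of "2 * x"] elim
        by (simp add: G)
      moreover have "x * tail (2 * x) > 0" using elim tail_pos[of "2 * x"] by simp
      moreover have "tail x \<le> K * tail (2 * x)" using elim tail_pos[of "2 * x"] by (simp add: field_simps)
      moreover have "K > 0" by (simp add: K_def add_pos_pos)
      ultimately have G_pos: "?G > 0" and tail_G: "tail x \<le> K / x * ?G"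
        using elim
        by (auto simp: field_simps intro: order_trans[OF mult_left_mono[of "tail x" _ x]])
      have "max_tail x \<le> (\<Sum>j. cycle_tail (x + real j * z))" using elim by (intro max_tail_le) simp
      also have "\<dots> \<le> c * (tail x + ?G / z)"
      proof (rule suminf_le_const)
        show "summable (\<lambda>j. cycle_tail (x + real j * z))" using elim by (intro summable_cycle_tail) simp
        fix n
        have "(\<Sum>j<n. cycle_tail (x + real j * z)) \<le> (\<Sum>j<n. c * tail (x + real j * z))"
          using elim z_pos by (intro sum_mono x0) (simp add: add_increasing2)
        also have "\<dots> \<le> c * (tail x + ?G / z)"
          unfolding sum_distrib_left[symmetric] G
          using c by (intro mult_left_mono sum_shift_le_integral[OF tail_int z_pos]) auto
        finally show "(\<Sum>j<n. cycle_tail (x + real j * z)) \<le> c * (tail x + ?G / z)" .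
      qed
      also have "\<dots> \<le> c * (K / x * ?G + ?G / z)" using tail_G c by (intro mult_left_mono add_mono) auto
      also have "\<dots> = c * (K / x + 1 / z) * ?G" by (simp add: algebra_simps)
      finally have "max_tail x / ?G \<le> c * (K / x + 1 / z)" using G_pos by (simp add: field_simps)
      then show ?thesis using elim by linarith
    qed
  qed
qed

end

text \<open>\<open>T\<close> is asymptotic to \<open>p\<close> times \<open>H\<close> and so
  inherits its regular variation: the two ratios \<open>T / H\<close> contribute
  \<open>p / p\<close>, and the ratio of \<open>L\<close> tends to 1.\<close>

lemma ratio_tendsto_powr:
  fixes T H L :: "real \<Rightarrow> real"
  assumes L: "slowly_varying L" and H: "\<And>x. x > 0 \<Longrightarrow> H x = L x * x powr (- r)"
    and p: "p \<noteq> 0" "((\<lambda>x. T x / H x) \<longlongrightarrow> p) at_top" and c: "c > 0"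
  shows "((\<lambda>x. T (c * x) / T x) \<longlongrightarrow> c powr (- r)) at_top"
proof -
  have scale: "filterlim (\<lambda>x. c * x) at_top at_top"
    by (rule filterlim_tendsto_pos_mult_at_top[OF tendsto_const c filterlim_ident])
  obtain A where A: "\<And>x. x \<ge> A \<Longrightarrow> L x > 0" using L by (auto simp: slowly_varying_def)
  \<comment> \<open>Positivity of \<open>L\<close> at \<open>x\<close> and at \<open>c * x\<close>
    makes \<open>H\<close> nonzero there, so the factors cancel in the identity below.\<close>
  have L0: "\<forall>\<^sub>F x in at_top. L x > 0" using A by (auto simp: eventually_at_top_linorder)
  have "((\<lambda>x. (T (c * x) / H (c * x)) / (T x / H x) * (L (c * x) / L x * c powr (- r)))
      \<longlongrightarrow> p / p * (1 * c powr (- r))) at_top"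
    using L c by (intro tendsto_intros p filterlim_compose[OF p(2) scale]) (simp add: slowly_varying_def)
  moreover have "\<forall>\<^sub>F x in at_top. (T (c * x) / H (c * x)) / (T x / H x) * (L (c * x) / L x * c powr (- r))
      = T (c * x) / T x"
    using L0 eventually_compose_filterlim[OF L0 scale] eventually_gt_at_top[of 0]
    by eventually_elim (use c in \<open>simp add: H powr_mult field_simps\<close>)
  ultimately show ?thesis using p(1) by (simp add: tendsto_cong)
qed

section \<open>The maximum of the walk\<close>

text \<open>The tail-sum formula for the mean. The work lies in the measurability of the passage
  time, which may be infinite.\<close>

lemma (in iid_walk) nn_integral_passage_time:
  "(\<integral>\<^sup>+\<omega>. ennreal_of_enat (passage_time Xs z \<omega>) \<partial>P)
    = (\<Sum>n. emeasure P {\<omega>\<in>space P. \<forall>j<Suc n. S j \<omega> > - z})"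
proof -
  \<comment> \<open>Exceeding \<open>n\<close> constrains all times from 0 through \<open>n\<close>,
    hence the bound \<open>Suc n\<close>.\<close>
  have less: "enat n < passage_time Xs z \<omega> \<longleftrightarrow> (\<forall>j<Suc n. S j \<omega> > - z)" for n \<omega>
  proof
    assume n: "enat n < passage_time Xs z \<omega>"
    show "\<forall>j<Suc n. S j \<omega> > - z"
    proof (intro allI impI, rule ccontr)
      fix j assume j: "j < Suc n" "\<not> S j \<omega> > - z"
      then have "passage_time Xs z \<omega> \<le> enat j"
        unfolding passage_time_def by (intro INF_lower) simp
      then show False using n j(1) by (auto dest: order.strict_trans2)
    qed
  next
    assume *: "\<forall>j<Suc n. S j \<omega> > - z"
    have "enat (Suc n) \<le> passage_time Xs z \<omega>"
      unfolding passage_time_def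
    proof (rule INF_greatest)
      fix k assume "k \<in> {k. S k \<omega> \<le> - z}"
      then have "\<not> k < Suc n" using * by (auto simp: not_less)
      then show "enat (Suc n) \<le> enat k" by simp
    qed
    then show "enat n < passage_time Xs z \<omega>" by (metis enat_ord_simps(2) lessI order.strict_trans2)
  qed
  have fin: "passage_time Xs z -` {enat n} \<inter> space P \<in> events" for n
  proof -
    have "passage_time Xs z \<omega> = enat n \<longleftrightarrow> \<not> enat n < passage_time Xs z \<omega> \<and> (\<forall>m<n. enat m < passage_time Xs z \<omega>)"
      for \<omega>
      by (cases "passage_time Xs z \<omega>") (auto simp: not_less order_le_less)
    then have "passage_time Xs z -` {enat n} \<inter> space P
      = {\<omega>\<in>space P. \<not> (\<forall>j<Suc n. S j \<omega> > - z) \<and> (\<forall>m<n. \<forall>j<Suc m. S j \<omega> > - z)}"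
      by (auto simp: less)
    also have "\<dots> \<in> events" by measurable
    finally show ?thesis .
  qed
  have "passage_time Xs z \<in> measurable P (count_space UNIV)"
  proof (rule measurable_count_space_eq2_countable[THEN iffD2], intro conjI ballI)
    fix a :: enat
    show "passage_time Xs z -` {a} \<inter> space P \<in> events"
    proof (cases a)
      \<comment> \<open>The level set at infinity is the complement of the countably many finite
        ones.\<close>
      case infinity
      then have "passage_time Xs z -` {a} \<inter> space P = space P - (\<Union>n. passage_time Xs z -` {enat n} \<inter> space P)"
        by auto
      moreover have "(\<Union>n. passage_time Xs z -` {enat n} \<inter> space P) \<in> events"
        by (intro sets.countable_UN) (use fin in auto)
      ultimately show ?thesis by simp
    qed (use fin in simp)
  qed auto
  from nn_integral_enat_function[OF this] show ?thesis by (simp add: less)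
qed

theorem corollary8:
  fixes P :: "'a measure" and X :: "'a \<Rightarrow> real" and Xs :: "nat \<Rightarrow> 'a \<Rightarrow> real"
    and L :: "real \<Rightarrow> real" and r p :: real
  assumes "prob_space P"
    and "integrable P X"
    and "- (\<integral>\<omega>. X \<omega> \<partial>P) > 0"
    and "prob_space.indep_vars P (\<lambda>_. borel) Xs {1..}"
    and "\<And>i. i \<ge> 1 \<Longrightarrow> distr P borel (Xs i) = distr P borel X"
    and "r > 1"
    and "slowly_varying L"
    and "\<And>x. x > 0 \<Longrightarrow> \<P>(\<omega> in P. \<bar>X \<omega>\<bar> > x) = L x * x powr (- r)"
    and "0 < p" and "p < 1"
    and "((\<lambda>x. \<P>(\<omega> in P. X \<omega> > x) / \<P>(\<omega> in P. \<bar>X \<omega>\<bar> > x)) \<longlongrightarrow> p) at_top"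
  shows "\<forall>\<theta>\<in>{0<..<1}. \<forall>z>0.
    Limsup at_top (\<lambda>x::real. ereal (\<P>(\<omega> in P. walk_max Xs \<omega> > ereal x) / integrated_tail P X x))
      \<le> enn2ereal (\<integral>\<^sup>+\<omega>. ennreal_of_enat (passage_time Xs z \<omega>) \<partial>P) / ereal z * ereal (\<theta> powr (- r))"
proof (intro ballI allI impI)
  fix \<theta> z :: real
  assume \<theta>: "\<theta> \<in> {0<..<1}" and z: "z > 0"
  interpret iid_walk P X Xs
    using assms by (intro iid_walk.intro iid_walk_axioms.intro) (auto simp: One_nat_def)
  let ?E = "\<integral>\<^sup>+\<omega>. ennreal_of_enat (passage_time Xs z \<omega>) \<partial>P"
  show "Limsup at_top (\<lambda>x::real. ereal (\<P>(\<omega> in P. walk_max Xs \<omega> > ereal x) / integrated_tail P X x))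
      \<le> enn2ereal ?E / ereal z * ereal (\<theta> powr (- r))"
  proof (cases "?E = \<infinity>")
    \<comment> \<open>The right-hand side is infinite, since \<open>z\<close> and
      \<open>\<theta> powr (- r)\<close> are positive.\<close>
    case True
    then show ?thesis using z \<theta> by simp
  next
    case False
    define e where "e = enn2real ?E"
    have e: "?E = ennreal e" "e \<ge> 0" using False by (auto simp: e_def less_top)
    have "(\<lambda>n. ennreal (prob {\<omega>\<in>space P. \<forall>j<Suc n. S j \<omega> > - z})) sums ennreal e"
      using e(1) by (simp add: nn_integral_passage_time emeasure_eq_measure sums_iff)
    then have sums: "(\<lambda>n. prob {\<omega>\<in>space P. \<forall>j<Suc n. S j \<omega> > - z}) sums e"
      using e(2) by (subst (asm) sums_ennreal) auto
    interpret iid_walk_cycle P X Xs z e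
      using z sums assms(2) by unfold_locales
    have reg: "((\<lambda>x. tail (c * x) / tail x) \<longlongrightarrow> c powr (- r)) at_top" if "c > 0" for c
      using assms that
      by (intro ratio_tendsto_powr[where H="\<lambda>x. \<P>(\<omega> in P. \<bar>X \<omega>\<bar> > x)" and L=L and p=p])
        (auto simp: tail_def)
    \<comment> \<open>The ratio tends to \<open>p > 0\<close>, so the tail is positive at
      arbitrarily large arguments, and by monotonicity everywhere.\<close>
    have pos: "tail x > 0" for x
    proof -
      have "\<forall>\<^sub>F y in at_top. \<P>(\<omega> in P. X \<omega> > y) / \<P>(\<omega> in P. \<bar>X \<omega>\<bar> > y) > 0"
        using assms by (intro order_tendstoD) auto
      then have "\<forall>\<^sub>F y in at_top. tail y > 0 \<and> y \<ge> x"
        using eventually_ge_at_top[of x]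
        by eventually_elim (auto simp: tail_def zero_less_divide_iff less_le)
      then obtain y where "tail y > 0" "y \<ge> x" using eventually_happens by force
      then show ?thesis using tail_antimono[of x y] by simp
    qed
    \<comment> \<open>A supremum strictly exceeds \<open>x\<close> exactly when some partial sum
      does, whether or not it is attained.\<close>
    have max: "\<P>(\<omega> in P. walk_max Xs \<omega> > ereal x) = max_tail x" for x
      by (simp add: walk_max_def max_tail_def less_SUP_iff)
    have bound: "enn2ereal ?E / ereal z * ereal (\<theta> powr (- r)) = ereal (e / z * \<theta> powr (- r))"
      using e z by (simp add: enn2ereal_ennreal)
    show ?thesis
      unfolding bound Limsup_le_iff max
    proof (intro allI impI)
      fix y assume y: "y > ereal (e / z * \<theta> powr (- r))"
      show "\<forall>\<^sub>F x in at_top. y > ereal (max_tail x / integrated_tail P X x)"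
      \<comment> \<open>Only real \<open>y\<close> carries content: plus infinity exceeds every real
        ratio, and minus infinity is excluded by the lower bound on \<open>y\<close>.\<close>
      proof (cases y)
        case (real y')
        then show ?thesis using max_tail_asymptotic_le[OF pos reg, of \<theta> y'] \<theta> y by simp
      qed (use y in auto)
    qed
  qed
qed

end
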